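(* For the $t$-fold wheel graph $W_{t,n}$, the multiset partition dimension is infinite: $\mathrm{mpd}(W_{t,n})=\infty$.
   Context: A $t$-fold wheel graph $W_{t,n}$ is a graph derived from a wheel (a cycle on $n$ vertices, called the rim, together with a hub vertex adjacent to all rim vertices) by duplicating the hub vertex one or more times, resulting in $t$ hub vertices, each adjacent to all rim vertices, and not adjacent to each other. $d(u,v)$ denotes the shortest-path distance. Let $G$ be a graph and let $\Pi=\{S_1,\dots,S_k\}$ be a partition of $V(G)$. For $v\in V(G)$ put $d(v,S_i)=\min\{d(v,x):x\in S_i\}$. The multiset partition representation of $v$ with respect to $\Pi$ is the multiset $r_{mp}(v\mid\Pi)=\{d(v,S_1),\dots,d(v,S_k)\}$ (order ignored, multiplicities kept). $\Pi$ is a resolving multiset partition if $r_{mp}(u\mid\Pi)\ne r_{mp}(v\mid\Pi)$ for all distinct $u,v\in V(G)$. The multiset partition dimension $\mathrm{mpd}(G)$ is the minimum number $k$ of parts of a resolving multiset partition of $G$, and $\mathrm{mpd}(G)=\infty$ if no resolving multiset partition exists. *)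

theory Defs
  imports
    "Graph_Theory.Graph_Theory"
    "Graph_Theory.Shortest_Path"
    "HOL-Library.Disjoint_Sets"
    "HOL-Library.Extended_Nat"
    "HOL-Library.Multiset"
begin

text \<open>Undirected simple graphs are the digraphs with symmetric, irreflexive arc set (locale
  \<^locale>\<open>graph\<close>). The distance is the shortest-path length for unit arc weights; it is
  \<open>\<infinity>\<close> between different components.\<close>

definition vdist :: "('a, 'b) pre_digraph \<Rightarrow> 'a \<Rightarrow> 'a \<Rightarrow> ereal" where
  "vdist G u v = wf_digraph.\<mu> G (\<lambda>_. 1) u v"

text \<open>The infimum is a minimum for nonempty \<open>S\<close>, because distances are natural numbers or
  \<open>\<infinity>\<close>.\<close>

definition set_dist :: "('a, 'b) pre_digraph \<Rightarrow> 'a \<Rightarrow> 'a set \<Rightarrow> ereal" where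
  "set_dist G v S = (INF x\<in>S. vdist G v x)"

definition mp_repr :: "('a, 'b) pre_digraph \<Rightarrow> 'a set set \<Rightarrow> 'a \<Rightarrow> ereal multiset" where
  "mp_repr G P v = {# set_dist G v S. S \<in># mset_set P #}"

definition resolving_mp :: "('a, 'b) pre_digraph \<Rightarrow> 'a set set \<Rightarrow> bool" where
  "resolving_mp G P \<longleftrightarrow> finite P \<and> partition_on (verts G) P \<and>
     (\<forall>u\<in>verts G. \<forall>v\<in>verts G. u \<noteq> v \<longrightarrow> mp_repr G P u \<noteq> mp_repr G P v)"

text \<open>In \<^typ>\<open>enat\<close> the infimum of a nonempty set is its minimum, and the infimum of the
  empty set is \<open>\<infinity>\<close>.\<close>

definition mpd :: "('a, 'b) pre_digraph \<Rightarrow> enat" where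
  "mpd G = (INF P\<in>{P. resolving_mp G P}. enat (card P))"

datatype wheel_vertex = Rim nat | Hub nat

definition rim_arcs :: "nat \<Rightarrow> wheel_vertex rel" where
  "rim_arcs n = {(Rim i, Rim j) | i j. i < n \<and> j < n \<and> (j = Suc i mod n \<or> i = Suc j mod n)}"

definition spokes :: "nat \<Rightarrow> nat \<Rightarrow> wheel_vertex rel" where
  "spokes t n = {(Hub h, Rim i) | h i. h < t \<and> i < n}"

definition tfold_wheel :: "nat \<Rightarrow> nat \<Rightarrow> wheel_vertex pair_pre_digraph" where
  "tfold_wheel t n =
     \<lparr> pverts = Rim ` {..<n} \<union> Hub ` {..<t},
       parcs = rim_arcs n \<union> spokes t n \<union> (spokes t n)\<inverse> \<rparr>"

lemma tfold_wheel_pair_graph: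
  assumes "n \<ge> 2"
  shows "pair_graph (tfold_wheel t n)"
proof -
  have sub: "parcs (tfold_wheel t n) \<subseteq> pverts (tfold_wheel t n) \<times> pverts (tfold_wheel t n)"
    by (auto simp: tfold_wheel_def rim_arcs_def spokes_def)
  have fin: "finite (pverts (tfold_wheel t n))"
    by (simp add: tfold_wheel_def)
  have loop: "Suc i mod n \<noteq> i" if "i < n" for i
    using that assms by (cases "Suc i = n") auto
  show ?thesis
  proof
    show "finite (parcs (tfold_wheel t n))"
      using finite_subset[OF sub] fin by simp
    show "symmetric (with_proj (tfold_wheel t n))"
      unfolding symmetric_def
      by (rule symI) (auto simp: tfold_wheel_def rim_arcs_def spokes_def)
    show "fst e \<noteq> snd e" if "e \<in> parcs (tfold_wheel t n)" for e
      using that by (auto simp: tfold_wheel_def rim_arcs_def spokes_def loop loop[symmetric])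
  qed (use sub fin in auto)
qed

lemma tfold_wheel_graph: "n \<ge> 2 \<Longrightarrow> graph (with_proj (tfold_wheel t n))"
  using tfold_wheel_pair_graph by (rule pair_graph.pair_graphD_graph)

end

theory Submission
  imports Defs
begin

text \<open>In a graph of diameter at most two, a representation with respect to \<open>k\<close> parts
  contains exactly one \<open>0\<close> and otherwise only \<open>1\<close>s and \<open>2\<close>s, so at most \<open>k\<close> representations
  occur. A resolving partition therefore has at least as many parts as there are vertices, i.e. all
  its parts are singletons. With respect to singletons, however, two non-adjacent vertices with the
  same neighbours, such as two hubs, have equal representations.\<close>

text \<open>Phrased through adjacency instead of \<open>vdist\<close>, so that a concrete graph can
  be checked from its arcs alone.\<close>

definition diameter_le_2 :: "('a, 'b) pre_digraph \<Rightarrow> bool" where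
  "diameter_le_2 G \<longleftrightarrow> (\<forall>u\<in>verts G. \<forall>v\<in>verts G. u \<noteq> v \<longrightarrow> \<not> u \<rightarrow>\<^bsub>G\<^esub> v \<longrightarrow>
     (\<exists>w. u \<rightarrow>\<^bsub>G\<^esub> w \<and> w \<rightarrow>\<^bsub>G\<^esub> v))"

text \<open>As \<open>vdist\<close> is an infimum over walks, an explicit walk with 0, 1 or 2 arcs
  bounds it from above, and a lower bound on the length of all walks from \<open>u\<close> to
  \<open>v\<close> bounds it from below.\<close>

lemma (in wf_digraph) vdist_diameter_le_2:
  assumes "diameter_le_2 G" and uv: "u \<in> verts G" "v \<in> verts G"
  shows "vdist G u v = (if u = v then 0 else if u \<rightarrow>\<^bsub>G\<^esub> v then 1 else 2)"
proof -
  have cost: "awalk_cost (\<lambda>_. 1) p = real (length p)" for p :: "'b list"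
    by (induction p) auto
  have upper: "vdist G u v \<le> ereal (real (length p))" if "awalk u p v" for p
    using min_cost_le_walk_cost[OF that, of "\<lambda>_. 1"] by (simp add: vdist_def cost)
  have lower: "ereal (real m) \<le> vdist G u v" if "\<And>p. awalk u p v \<Longrightarrow> m \<le> length p" for m
    unfolding vdist_def \<mu>_def cost using that by (intro INF_greatest) auto
  have arcE: "\<exists>e. e \<in> arcs G \<and> tail G e = x \<and> head G e = y" if "x \<rightarrow>\<^bsub>G\<^esub> y" for x y
    using that by (auto simp: arcs_ends_def arc_to_ends_def)
  have nonempty: "1 \<le> length p" if "awalk u p v" "u \<noteq> v" for p
    using that by (cases p) (auto simp: awalk_Nil_iff)
  consider "u = v" | "u \<noteq> v" "u \<rightarrow>\<^bsub>G\<^esub> v" | "u \<noteq> v" "\<not> u \<rightarrow>\<^bsub>G\<^esub> v"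
    by blast
  then show ?thesis
  proof cases
    case 1
    then show ?thesis
      using upper[of "[]"] lower[of 0] uv by (auto simp: awalk_Nil_iff zero_ereal_def)
  next
    case 2
    then obtain e where "e \<in> arcs G" "tail G e = u" "head G e = v"
      using arcE by blast
    then have "vdist G u v \<le> 1"
      using upper[of "[e]"] uv by (auto simp: awalk_simps one_ereal_def)
    then show ?thesis
      using 2 lower[of 1] nonempty by (auto simp: one_ereal_def)
  next
    case 3
    then obtain w where "u \<rightarrow>\<^bsub>G\<^esub> w" "w \<rightarrow>\<^bsub>G\<^esub> v"
      using assms unfolding diameter_le_2_def by blast
    then obtain e f where "e \<in> arcs G" "tail G e = u" "head G e = w"
      "f \<in> arcs G" "tail G f = w" "head G f = v"
      using arcE by meson
    then have "vdist G u v \<le> 2"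
      using upper[of "[e, f]"] uv by (auto simp: awalk_simps)
    \<comment> \<open>A shorter walk between distinct vertices would be a single arc from
      \<open>u\<close> to \<open>v\<close>.\<close>
    moreover have "2 \<le> length p" if p: "awalk u p v" for p
    proof (rule ccontr)
      assume "\<not> 2 \<le> length p"
      then have "length p = 1"
        using nonempty[OF p 3(1)] by simp
      then obtain a where "p = [a]"
        by (auto simp: length_Suc_conv)
      then have "u \<rightarrow>\<^bsub>G\<^esub> v"
        using p by (auto simp: awalk_simps intro: in_arcs_imp_in_arcs_ends)
      then show False
        using 3 by simp
    qed
    ultimately show ?thesis
      using 3 lower[of 2] by (auto intro: antisym)
  qed
qed

lemma Inf_in_self_finite:
  fixes A :: "'a::complete_linorder set"
  assumes "finite A" "A \<noteq> {}"
  shows "Inf A \<in> A"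
  using assms by (simp flip: Min_Inf)

text \<open>\<open>S\<close> is finite, so the infimum is attained and is one of the values 0, 1, 2.
  The value 0 arises only as the distance from \<open>v\<close> to itself.\<close>

lemma (in fin_digraph) set_dist_diameter_le_2:
  assumes "diameter_le_2 G" "v \<in> verts G" "S \<subseteq> verts G" "S \<noteq> {}"
  shows "set_dist G v S \<in> (if v \<in> S then {0} else {1, 2})"
proof -
  have "finite S"
    using assms by (meson finite_subset finite_verts)
  then have "set_dist G v S \<in> vdist G v ` S"
    unfolding set_dist_def using assms by (intro Inf_in_self_finite) auto
  moreover have "set_dist G v S \<le> vdist G v v" if "v \<in> S"
    unfolding set_dist_def using that by (rule INF_lower)
  ultimately show ?thesis
    using assms by (auto simp: vdist_diameter_le_2 subset_iff split: if_splits)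
qed

text \<open>For distinct \<open>a\<close> and \<open>b\<close> the size is the sum of the two
  counts, so size and count of \<open>b\<close> also fix the count of \<open>a\<close>. For
  \<open>a = b\<close> the size alone decides.\<close>

lemma mset_two_values_eqI:
  assumes "set_mset A \<subseteq> {a, b}" "set_mset B \<subseteq> {a, b}" "size A = size B" "count A b = count B b"
  shows "A = B"
proof (cases "a = b")
  case True
  then show ?thesis
    using assms by (metis insert_absorb2 set_mset_subset_singletonD)
next
  case False
  have size: "size C = count C a + count C b" if "set_mset C \<subseteq> {a, b}" for C
    using that False size_multiset_overloaded_eq[of C] sum.mono_neutral_left[of "{a, b}" "set_mset C" "count C"]
    by (auto simp: not_in_iff)
  show ?thesis
  proof (rule multiset_eqI)
    fix x
    show "count A x = count B x"
    proof (cases "x \<in> {a, b}")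
      case True
      then show ?thesis
        using assms size[of A] size[of B] by auto
    next
      case False
      then show ?thesis
        using assms by (metis not_in_iff subsetD)
    qed
  qed
qed

text \<open>Choosing one element from each part injects \<open>P\<close> into \<open>A\<close>. By
  cardinality the choice is onto, so no part has room for an element that was not chosen.\<close>

lemma partition_on_card_ge_imp_singletons:
  assumes P: "partition_on A P" and "finite A" "card A \<le> card P"
  shows "P = (\<lambda>x. {x}) ` A"
proof -
  define f where "f S = (SOME x. x \<in> S)" for S :: "'a set"
  have f: "f S \<in> S" if "S \<in> P" for S
    using that P unfolding f_def partition_on_def by (metis some_in_eq)
  have fA: "f ` P \<subseteq> A"
    using f P by (auto simp: partition_on_def)
  have disj: "S = T" if "S \<in> P" "T \<in> P" "x \<in> S" "x \<in> T" for S T x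
    using that P by (auto simp: partition_on_def disjoint_def)
  have "inj_on f P"
    using f disj by (intro inj_onI) metis
  then have "card (f ` P) = card P"
    by (rule card_image)
  then have onto: "f ` P = A"
    using fA assms by (intro card_seteq) auto
  have single: "S = {f S}" if "S \<in> P" for S
  proof -
    have "x = f S" if "x \<in> S" for x
    proof -
      have "x \<in> f ` P"
        using that \<open>S \<in> P\<close> P onto by (auto simp: partition_on_def)
      then show ?thesis
        using disj f that \<open>S \<in> P\<close> by auto
    qed
    then show ?thesis
      using f that by auto
  qed
  then have "P = (\<lambda>x. {x}) ` (f ` P)"
    by (force simp: image_image)
  then show ?thesis
    using onto by simp
qed

text \<open>A representation is determined by its number of 2s, which is below
  \<open>card P\<close>. Distinct vertices must differ in this number, so there are at most
  \<open>card P\<close> of them.\<close>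

lemma (in fin_digraph) resolving_mp_imp_singletons:
  assumes diam: "diameter_le_2 G" and "resolving_mp G P"
  shows "P = (\<lambda>v. {v}) ` verts G"
proof -
  have fin: "finite P" and P: "partition_on (verts G) P"
    and res: "\<And>u v. u \<in> verts G \<Longrightarrow> v \<in> verts G \<Longrightarrow> mp_repr G P u = mp_repr G P v \<Longrightarrow> u = v"
    using assms by (auto simp: resolving_mp_def)
  \<comment> \<open>The entry 0 belongs to the unique part containing \<open>v\<close>, and
    \<open>M\<close> collects the other parts. Positivity of \<open>card P\<close> is recorded
    because the subtraction is truncated.\<close>
  have split: "\<exists>M. mp_repr G P v = add_mset 0 M \<and> size M = card P - 1 \<and> set_mset M \<subseteq> {1, 2}
      \<and> 0 < card P" if v: "v \<in> verts G" for v
  proof -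
    obtain S where S: "S \<in> P" "v \<in> S"
      using v P by (auto simp: partition_on_def)
    have "set_dist G v T \<in> (if v \<in> T then {0} else {1, 2})" if "T \<in> P" for T
      using that P by (intro set_dist_diameter_le_2[OF diam v]) (auto simp: partition_on_def)
    moreover have "v \<notin> T" if "T \<in> P" "T \<noteq> S" for T
      using that S P by (auto simp: partition_on_def disjoint_def)
    ultimately have "set_dist G v S = 0" "set_dist G v ` (P - {S}) \<subseteq> {1, 2}"
      using S by force+
    moreover have "mset_set P = add_mset S (mset_set (P - {S}))"
      using fin S by (metis mset_set.remove)
    ultimately have "mp_repr G P v = add_mset 0 {# set_dist G v T. T \<in># mset_set (P - {S}) #}"
      by (simp add: mp_repr_def)
    then show ?thesis
      using fin S \<open>set_dist G v ` (P - {S}) \<subseteq> {1, 2}\<close>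
      by (intro exI[of _ "{# set_dist G v T. T \<in># mset_set (P - {S}) #}"])
        (auto simp: card_gt_0_iff)
  qed
  have "inj_on (\<lambda>v. count (mp_repr G P v) 2) (verts G)"
  proof (intro inj_onI res)
    fix u v
    assume u: "u \<in> verts G" and v: "v \<in> verts G"
      and eq: "count (mp_repr G P u) 2 = count (mp_repr G P v) 2"
    from split[OF u] split[OF v] obtain M N where
      "mp_repr G P u = add_mset 0 M" "size M = card P - 1" "set_mset M \<subseteq> {1, 2}"
      "mp_repr G P v = add_mset 0 N" "size N = card P - 1" "set_mset N \<subseteq> {1, 2}"
      by metis
    then show "mp_repr G P u = mp_repr G P v"
      using eq mset_two_values_eqI[of M 1 2 N] by simp
  qed
  moreover have "count (mp_repr G P v) 2 < card P" if v: "v \<in> verts G" for v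
  proof -
    obtain M where "mp_repr G P v = add_mset 0 M" "size M = card P - 1" "0 < card P"
      using split[OF v] by metis
    then show ?thesis
      using count_le_size[of M 2] by simp
  qed
  ultimately have "card (verts G) \<le> card {..<card P}"
    by (intro card_inj_on_le) auto
  then show ?thesis
    using P by (intro partition_on_card_ge_imp_singletons) auto
qed

text \<open>The map from \<open>v\<close> to \<open>{v}\<close> is injective, so parts can be
  reindexed by vertices with multiplicities intact, and the infimum over a singleton is its only
  distance.\<close>

lemma mp_repr_singletons:
  assumes "finite A"
  shows "mp_repr G ((\<lambda>v. {v}) ` A) u = {# vdist G u v. v \<in># mset_set A #}"
proof -
  have "mset_set ((\<lambda>v. {v}) ` A) = image_mset (\<lambda>v. {v}) (mset_set A)"
    by (simp add: image_mset_mset_set)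
  then show ?thesis
    by (simp add: mp_repr_def set_dist_def multiset.map_comp comp_def)
qed

lemma (in fin_digraph) mpd_infinite_if_twins:
  assumes diam: "diameter_le_2 G"
    and u: "u \<in> verts G" and v: "v \<in> verts G" and "u \<noteq> v"
    and "\<not> u \<rightarrow>\<^bsub>G\<^esub> v" "\<not> v \<rightarrow>\<^bsub>G\<^esub> u"
    and twins: "\<And>w. w \<in> verts G \<Longrightarrow> u \<rightarrow>\<^bsub>G\<^esub> w \<longleftrightarrow> v \<rightarrow>\<^bsub>G\<^esub> w"
  shows "mpd G = \<infinity>"
proof -
  have "\<not> resolving_mp G P" for P
  proof
    assume res: "resolving_mp G P"
    then have P: "P = (\<lambda>v. {v}) ` verts G"
      using diam by (rule resolving_mp_imp_singletons[rotated])
    define W where "W = verts G - {u, v}"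
    have "verts G = insert u (insert v W)" "finite W" "u \<notin> W" "v \<notin> W"
      using u v by (auto simp: W_def)
    then have V: "mset_set (verts G) = {#u, v#} + mset_set W"
      using \<open>u \<noteq> v\<close> by simp
    \<comment> \<open>Away from \<open>u\<close> and \<open>v\<close> a distance depends only on
      adjacency, where the twins agree.\<close>
    have "image_mset (vdist G u) (mset_set W) = image_mset (vdist G v) (mset_set W)"
      using diam u v twins by (intro image_mset_cong) (auto simp: W_def vdist_diameter_le_2)
    \<comment> \<open>The parts \<open>{u}\<close> and \<open>{v}\<close> contribute 0 and 2 to one
      representation, 2 and 0 to the other; the multiset forgets the order.\<close>
    then have "mp_repr G P u = mp_repr G P v"
      using assms unfolding P mp_repr_singletons[OF finite_verts] V
      by (simp add: vdist_diameter_le_2)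
    then show False
      using res u v \<open>u \<noteq> v\<close> by (auto simp: resolving_mp_def)
  qed
  then show ?thesis
    by (simp add: mpd_def top_enat_def)
qed

text \<open>Two rim vertices meet at \<open>Hub 0\<close>, two hubs at \<open>Rim 0\<close>; a hub
  and a rim vertex are always adjacent.\<close>

lemma diameter_tfold_wheel:
  assumes "t \<ge> 1" "n \<ge> 1"
  shows "diameter_le_2 (with_proj (tfold_wheel t n))"
  unfolding diameter_le_2_def
proof (intro ballI impI)
  let ?G = "with_proj (tfold_wheel t n)"
  fix u v
  assume uv: "u \<in> verts ?G" "v \<in> verts ?G" "\<not> u \<rightarrow>\<^bsub>?G\<^esub> v"
  show "\<exists>w. u \<rightarrow>\<^bsub>?G\<^esub> w \<and> w \<rightarrow>\<^bsub>?G\<^esub> v"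
  proof (cases u; cases v)
    fix i j assume "u = Rim i" "v = Rim j"
    then show ?thesis
      using uv assms by (intro exI[of _ "Hub 0"]) (auto simp: tfold_wheel_def spokes_def)
  next
    fix i j assume "u = Hub i" "v = Hub j"
    then show ?thesis
      using uv assms by (intro exI[of _ "Rim 0"]) (auto simp: tfold_wheel_def spokes_def)
  qed (use uv in \<open>auto simp: tfold_wheel_def spokes_def\<close>)
qed

theorem theorem4p5:
  fixes t n :: nat
  assumes "t \<ge> 2" and "n \<ge> 3"
  shows "mpd (with_proj (tfold_wheel t n)) = \<infinity>"
proof -
  interpret graph "with_proj (tfold_wheel t n)"
    using assms by (intro tfold_wheel_graph) simp
  \<comment> \<open>Two hubs serve as the twins: they are not adjacent, and the neighbours of each
    are exactly the rim vertices.\<close>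
  have "Hub 0 \<in> verts (with_proj (tfold_wheel t n))" "Hub 1 \<in> verts (with_proj (tfold_wheel t n))"
    using assms by (auto simp: tfold_wheel_def)
  then show ?thesis
    using assms
    by (intro mpd_infinite_if_twins[of "Hub 0" "Hub 1"] diameter_tfold_wheel)
      (auto simp: tfold_wheel_def rim_arcs_def spokes_def)
qed

end
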